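(* Let $a\in\mathbb Q$, and set $L=\partial_t-a\,\partial_x$ on $\mathbb T^2$. Then, for every $k_1,k_2\in\mathbb R$, there exists a nonzero distribution $u\in\mathcal D'(\mathbb T^2)$ such that $$Lu=0\qquad\text{and}\qquad u\notin H_{\mathrm{mix}}^{(k_1,k_2)}(\mathbb T^2).$$
   Context: $\mathbb T=\mathbb R/2\pi\mathbb Z$, with variables $(t,x)\in\mathbb T^2$ and dual frequencies $(\tau,\xi)\in\mathbb Z^2$. $\mathcal D'(\mathbb T^2)$ is the space of distributions on $\mathbb T^2$. Fourier coefficients are $\widehat f(\tau,\xi)=\frac1{(2\pi)^2}\int_{\mathbb T^2}f(t,x)e^{-i(t\tau+x\xi)}\,dt\,dx$ (by duality for distributions). $\langle w\rangle=(1+|w|^2)^{1/2}$. For $s_1,s_2\in\mathbb R$, $H_{\mathrm{mix}}^{(s_1,s_2)}(\mathbb T^2)$ is the space of $f\in\mathcal D'(\mathbb T^2)$ with $\sum_{(\tau,\xi)\in\mathbb Z^2}\langle\tau\rangle^{2s_1}\langle\xi\rangle^{2s_2}|\widehat f(\tau,\xi)|^2<\infty$. *)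

theory Defs
  imports "HOL-Analysis.Analysis"
begin

section \<open>Test functions on the torus\<close>

text \<open>Functions on the torus (the square of the reals modulo 2 pi) are functions of
  \<open>(t, x)\<close> on the plane that are 2 pi-periodic in both variables.\<close>

definition partial_t :: "(real \<times> real \<Rightarrow> complex) \<Rightarrow> real \<times> real \<Rightarrow> complex" where
  "partial_t f z = frechet_derivative f (at z) (1, 0)"

definition partial_x :: "(real \<times> real \<Rightarrow> complex) \<Rightarrow> real \<times> real \<Rightarrow> complex" where
  "partial_x f z = frechet_derivative f (at z) (0, 1)"

primrec C_k :: "nat \<Rightarrow> (real \<times> real \<Rightarrow> complex) \<Rightarrow> bool" where
  "C_k 0 f \<longleftrightarrow> continuous_on UNIV f"
| "C_k (Suc k) f \<longleftrightarrow> f differentiable_on UNIV \<and> C_k k (partial_t f) \<and> C_k k (partial_x f)"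

definition test_functions :: "(real \<times> real \<Rightarrow> complex) set" where
  "test_functions = {\<phi>. (\<forall>k. C_k k \<phi>) \<and>
     (\<forall>t x. \<phi> (t + 2 * pi, x) = \<phi> (t, x) \<and> \<phi> (t, x + 2 * pi) = \<phi> (t, x))}"

section \<open>Distributions on the torus\<close>

type_synonym functional = "(real \<times> real \<Rightarrow> complex) \<Rightarrow> complex"

text \<open>Convergence in the Frechet space of test functions: uniform convergence of all
  derivatives.\<close>

definition test_converges ::
  "(nat \<Rightarrow> real \<times> real \<Rightarrow> complex) \<Rightarrow> (real \<times> real \<Rightarrow> complex) \<Rightarrow> bool" where
  "test_converges \<phi> \<psi> \<longleftrightarrow> (\<forall>i j. uniform_limit UNIV
     (\<lambda>n. (partial_t ^^ i) ((partial_x ^^ j) (\<phi> n)))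
     ((partial_t ^^ i) ((partial_x ^^ j) \<psi>)) sequentially)"

text \<open>Since the space of test functions is metrizable, continuity of a linear functional is
  sequential continuity.  Functionals are total HOL functions; they are normalised to 0 outside
  the test functions, so that equality of distributions is equality of HOL functions.\<close>

definition distributions :: "functional set" where
  "distributions = {u.
     (\<forall>\<phi>\<in>test_functions. \<forall>\<psi>\<in>test_functions. u (\<lambda>z. \<phi> z + \<psi> z) = u \<phi> + u \<psi>) \<and>
     (\<forall>\<phi>\<in>test_functions. \<forall>c. u (\<lambda>z. c * \<phi> z) = c * u \<phi>) \<and>
     (\<forall>\<phi> \<psi>. (\<forall>n. \<phi> n \<in> test_functions) \<longrightarrow> \<psi> \<in> test_functions \<longrightarrow> test_converges \<phi> \<psi> \<longrightarrow>
        (\<lambda>n. u (\<phi> n)) \<longlonglongrightarrow> u \<psi>) \<and>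
     (\<forall>\<phi>. \<phi> \<notin> test_functions \<longrightarrow> u \<phi> = 0)}"

text \<open>The guards keep the normalisation: a derivative may be periodic although the function
  itself is not.\<close>

definition dist_t :: "functional \<Rightarrow> functional" where
  "dist_t u = (\<lambda>\<phi>. if \<phi> \<in> test_functions then - u (partial_t \<phi>) else 0)"

definition dist_x :: "functional \<Rightarrow> functional" where
  "dist_x u = (\<lambda>\<phi>. if \<phi> \<in> test_functions then - u (partial_x \<phi>) else 0)"

definition L_op :: "real \<Rightarrow> functional \<Rightarrow> functional" where
  "L_op a u = (\<lambda>\<phi>. dist_t u \<phi> - of_real a * dist_x u \<phi>)"

section \<open>Fourier coefficients and mixed Sobolev spaces\<close>

text \<open>A function \<open>f\<close> is identified with the functional sending \<open>\<phi>\<close> to the integral of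
  \<open>f * \<phi>\<close> over the torus (bilinear pairing, no conjugation, no normalising factor), so the
  factor \<open>1 / (2 pi)^2\<close> appears here.\<close>

definition fourier_coeff :: "functional \<Rightarrow> int \<Rightarrow> int \<Rightarrow> complex" where
  "fourier_coeff u \<tau> \<xi> =
     1 / (2 * of_real pi)\<^sup>2 *
     u (\<lambda>(t, x). exp (- \<i> * of_real (t * of_int \<tau> + x * of_int \<xi>)))"

definition japanese_bracket :: "real \<Rightarrow> real" where
  "japanese_bracket w = (1 + \<bar>w\<bar>\<^sup>2) powr (1 / 2)"

definition H_mix :: "real \<Rightarrow> real \<Rightarrow> functional set" where
  "H_mix s1 s2 = {u \<in> distributions.
     (\<lambda>(\<tau>, \<xi>). japanese_bracket (of_int \<tau>) powr (2 * s1) *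
        japanese_bracket (of_int \<xi>) powr (2 * s2) *
        (cmod (fourier_coeff u \<tau> \<xi>))\<^sup>2) summable_on (UNIV :: (int \<times> int) set)}"

end

theory Submission
  imports Defs
begin

text \<open>Write \<open>a = p / q\<close>, so that the curves \<open>s \<mapsto> (q s, x - p s)\<close> are closed orbits of the
  vector field of \<open>L\<close>.  The averages of \<open>L \<phi>\<close> along all these orbits vanish, hence so do their
  derivatives in \<open>x\<close>.  Therefore the distribution that integrates the \<open>N\<close>-th \<open>x\<close>-derivative along the
  orbit with \<open>x = 0\<close> is annihilated by \<open>L\<close>, while its Fourier coefficients at \<open>(p n, q n)\<close> grow
  like \<open>n\<^sup>N\<close>, which for large \<open>N\<close> is too fast for the given mixed Sobolev space.\<close>

section \<open>Differential calculus of test functions\<close>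

lemma test_functions_C_k: "\<phi> \<in> test_functions \<Longrightarrow> C_k k \<phi>"
  by (simp add: test_functions_def)

lemma test_functions_differentiable:
  assumes "\<phi> \<in> test_functions"
  shows "\<phi> differentiable (at z)"
proof -
  have "C_k (Suc 0) \<phi>"
    using assms by (rule test_functions_C_k)
  then show ?thesis
    by (cases z) (simp add: differentiable_on_def)
qed

lemma frechet_derivative_eq_partials:
  assumes "f differentiable (at z)"
  shows "frechet_derivative f (at z) (h, k) = h *\<^sub>R partial_t f z + k *\<^sub>R partial_x f z"
proof -
  note lin = linear_frechet_derivative[OF assms]
  have "frechet_derivative f (at z) (h, k) =
      frechet_derivative f (at z) (h *\<^sub>R (1, 0) + k *\<^sub>R (0, 1))"
    by simp
  then show ?thesis
    by (simp only: linear_add[OF lin] linear_scale[OF lin] partial_t_def partial_x_def)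
qed

lemma test_functions_has_derivative:
  assumes "\<phi> \<in> test_functions"
  shows "(\<phi> has_derivative (\<lambda>(h, k). h *\<^sub>R partial_t \<phi> z + k *\<^sub>R partial_x \<phi> z)) (at z)"
proof -
  note d = test_functions_differentiable[OF assms]
  have "frechet_derivative \<phi> (at z) = (\<lambda>(h, k). h *\<^sub>R partial_t \<phi> z + k *\<^sub>R partial_x \<phi> z)"
    by (rule ext, simp only: split_paired_all prod.case) (rule frechet_derivative_eq_partials[OF d])
  with d[of z] show ?thesis
    by (simp only: frechet_derivative_works)
qed

lemma test_functions_continuous:
  assumes "\<phi> \<in> test_functions"
  shows "continuous_on A \<phi>"
  using test_functions_C_k[OF assms, of 0] continuous_on_subset by auto

lemma partial_unique:
  assumes "(f has_derivative f') (at z)"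
  shows "partial_t f z = f' (1, 0)" "partial_x f z = f' (0, 1)"
  using frechet_derivative_at[OF assms] by (simp_all add: partial_t_def partial_x_def)

text \<open>Chain rule with the translation by \<open>c\<close>, whose derivative is the identity.
  It transfers periodicity from a function to its partial derivatives.\<close>

lemma frechet_derivative_shift:
  fixes f :: "'a::real_normed_vector \<Rightarrow> 'b::real_normed_vector"
  assumes "\<And>z. f differentiable (at z)" "\<And>z. f (z + c) = f z"
  shows "frechet_derivative f (at (z + c)) = frechet_derivative f (at z)"
proof -
  have "(f has_derivative frechet_derivative f (at (z + c))) (at (z + c))"
    using assms(1) by (simp add: frechet_derivative_works)
  moreover have "((\<lambda>y. y + c) has_derivative (\<lambda>h. h)) (at z)"
    by (intro has_derivative_add_const has_derivative_ident)
  ultimately have "((\<lambda>y. f (y + c)) has_derivative frechet_derivative f (at (z + c))) (at z)"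
    by (rule has_derivative_compose[rotated])
  then show ?thesis
    using assms(2) by (simp add: frechet_derivative_at)
qed

lemma partial_test_functions:
  assumes "\<phi> \<in> test_functions"
  shows "partial_t \<phi> \<in> test_functions" "partial_x \<phi> \<in> test_functions"
proof -
  have "C_k k (partial_t \<phi>)" "C_k k (partial_x \<phi>)" for k
    using test_functions_C_k[OF assms, of "Suc k"] by simp_all
  moreover have "\<phi> (z + (2 * pi, 0)) = \<phi> z" "\<phi> (z + (0, 2 * pi)) = \<phi> z" for z
    using assms by (cases z; simp add: test_functions_def)+
  note this[THEN frechet_derivative_shift[OF test_functions_differentiable[OF assms]], of "(_, _)"]
  ultimately show "partial_t \<phi> \<in> test_functions" "partial_x \<phi> \<in> test_functions"
    by (simp_all add: test_functions_def partial_t_def partial_x_def)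
qed

lemma partial_x_funpow_test_functions:
  "\<phi> \<in> test_functions \<Longrightarrow> (partial_x ^^ N) \<phi> \<in> test_functions"
  by (induction N) (simp_all add: partial_test_functions)

text \<open>\<open>frechet_derivative\<close> is defined by choice, so linearity is derived from
  uniqueness of a derivative that is known to exist.\<close>

lemma partial_add:
  assumes "f differentiable (at z)" "g differentiable (at z)"
  shows "partial_t (\<lambda>z. f z + g z) z = partial_t f z + partial_t g z"
    "partial_x (\<lambda>z. f z + g z) z = partial_x f z + partial_x g z"
  using assms partial_unique[OF has_derivative_add]
  unfolding frechet_derivative_works partial_t_def partial_x_def by blast+

lemma partial_cmult:
  assumes "f differentiable (at z)"
  shows "partial_t (\<lambda>z. c * f z) z = c * partial_t f z"
    "partial_x (\<lambda>z. c * f z) z = c * partial_x f z"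
  using assms partial_unique[OF has_derivative_mult_right]
  unfolding frechet_derivative_works partial_t_def partial_x_def by blast+

lemma C_k_differentiable: "C_k (Suc k) f \<Longrightarrow> f differentiable (at z)"
  by (cases z) (simp add: differentiable_on_def)

lemma C_k_add: "C_k k f \<Longrightarrow> C_k k g \<Longrightarrow> C_k k (\<lambda>z. f z + g z)"
proof (induction k arbitrary: f g)
  case 0
  then show ?case
    by (simp add: continuous_on_add)
next
  case (Suc k)
  note d = Suc.prems[THEN C_k_differentiable]
  have "partial_t (\<lambda>z. f z + g z) = (\<lambda>z. partial_t f z + partial_t g z)"
    "partial_x (\<lambda>z. f z + g z) = (\<lambda>z. partial_x f z + partial_x g z)"
    using d by (auto simp: partial_add)
  with Suc show ?case
    by (simp add: differentiable_on_def)
qed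

lemma C_k_cmult: "C_k k f \<Longrightarrow> C_k k (\<lambda>z. c * f z)"
proof (induction k arbitrary: f)
  case 0
  then show ?case
    by (simp add: continuous_on_mult_left)
next
  case (Suc k)
  note d = Suc.prems[THEN C_k_differentiable]
  have "partial_t (\<lambda>z. c * f z) = (\<lambda>z. c * partial_t f z)"
    "partial_x (\<lambda>z. c * f z) = (\<lambda>z. c * partial_x f z)"
    using d by (auto simp: partial_cmult)
  with Suc show ?case
    by (simp add: differentiable_on_def)
qed

lemma test_functions_add:
  "\<phi> \<in> test_functions \<Longrightarrow> \<psi> \<in> test_functions \<Longrightarrow> (\<lambda>z. \<phi> z + \<psi> z) \<in> test_functions"
  by (simp add: test_functions_def C_k_add)

lemma test_functions_cmult: "\<phi> \<in> test_functions \<Longrightarrow> (\<lambda>z. c * \<phi> z) \<in> test_functions"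
  by (simp add: test_functions_def C_k_cmult)

lemma partial_x_funpow_add:
  assumes "\<phi> \<in> test_functions" "\<psi> \<in> test_functions"
  shows "(partial_x ^^ N) (\<lambda>z. \<phi> z + \<psi> z) = (\<lambda>z. (partial_x ^^ N) \<phi> z + (partial_x ^^ N) \<psi> z)"
  by (induction N)
    (auto simp: partial_add test_functions_differentiable partial_x_funpow_test_functions assms)

lemma partial_x_funpow_cmult:
  assumes "\<phi> \<in> test_functions"
  shows "(partial_x ^^ N) (\<lambda>z. c * \<phi> z) = (\<lambda>z. c * (partial_x ^^ N) \<phi> z)"
  by (induction N)
    (auto simp: partial_cmult test_functions_differentiable partial_x_funpow_test_functions assms)

section \<open>Periodicity and integrals along closed orbits\<close>

lemma periodic_int_shift:
  fixes f :: "real \<Rightarrow> 'a"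
  assumes "\<And>x. f (x + c) = f x"
  shows "f (x + of_int n * c) = f x"
proof (induction n rule: int_induct[where k = 0])
  case (step1 i)
  then show ?case
    using assms[of "x + of_int i * c"] by (simp add: algebra_simps)
next
  case (step2 i)
  then show ?case
    using assms[of "x + of_int (i - 1) * c"] by (simp add: algebra_simps)
qed simp

lemma test_functions_periodic:
  assumes "\<phi> \<in> test_functions"
  shows "\<phi> (t + of_int m * (2 * pi), x + of_int n * (2 * pi)) = \<phi> (t, x)"
  using assms periodic_int_shift[of "\<lambda>x. \<phi> (t + of_int m * (2 * pi), x)" "2 * pi" x n]
    periodic_int_shift[of "\<lambda>t. \<phi> (t, x)" "2 * pi" t m]
  by (simp add: test_functions_def)

definition orbit_integral :: "int \<Rightarrow> int \<Rightarrow> (real \<times> real \<Rightarrow> complex) \<Rightarrow> real \<Rightarrow> complex" where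
  "orbit_integral p q \<phi> x = integral {0..2 * pi} (\<lambda>s. \<phi> (of_int q * s, x - of_int p * s))"

lemma orbit_continuous:
  assumes "\<phi> \<in> test_functions"
  shows "continuous_on A (\<lambda>s. \<phi> (of_int q * s, x - of_int p * s))"
  by (intro continuous_on_compose2[OF test_functions_continuous[OF assms, of UNIV]]
      continuous_intros) simp

lemma orbit_integrable:
  assumes "\<phi> \<in> test_functions"
  shows "(\<lambda>s. \<phi> (of_int q * s, x - of_int p * s)) integrable_on {0..2 * pi}"
  by (intro integrable_continuous_real orbit_continuous assms)

lemma orbit_integral_add:
  assumes "\<phi> \<in> test_functions" "\<psi> \<in> test_functions"
  shows "orbit_integral p q (\<lambda>z. \<phi> z + \<psi> z) x = orbit_integral p q \<phi> x + orbit_integral p q \<psi> x"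
  unfolding orbit_integral_def by (intro integral_add orbit_integrable assms)

lemma orbit_integral_cmult: "orbit_integral p q (\<lambda>z. c * \<phi> z) x = c * orbit_integral p q \<phi> x"
  unfolding orbit_integral_def by simp

text \<open>Differentiation under the integral sign: \<open>x\<close> enters the integrand only as a
  translation in the second variable, and \<open>partial_x \<phi>\<close> is continuous.\<close>

lemma orbit_integral_has_vector_derivative:
  assumes "\<phi> \<in> test_functions"
  shows "(orbit_integral p q \<phi> has_vector_derivative orbit_integral p q (partial_x \<phi>) x) (at x)"
proof -
  have "((\<lambda>x. integral (cbox 0 (2 * pi)) (\<lambda>s. \<phi> (of_int q * s, x - of_int p * s)))
      has_vector_derivative
      integral (cbox 0 (2 * pi)) (\<lambda>s. partial_x \<phi> (of_int q * s, x - of_int p * s)))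
      (at x within UNIV)"
  proof (rule leibniz_rule_vector_derivative)
    fix y s :: real
    have "((\<lambda>y. (of_int q * s, y - of_int p * s)) has_derivative (\<lambda>h. (0, h - 0))) (at y)"
      by (intro has_derivative_Pair has_derivative_diff has_derivative_const has_derivative_ident)
    from has_derivative_compose[OF this test_functions_has_derivative[OF assms]]
    show "((\<lambda>y. \<phi> (of_int q * s, y - of_int p * s)) has_vector_derivative
        partial_x \<phi> (of_int q * s, y - of_int p * s)) (at y within UNIV)"
      by (simp add: has_vector_derivative_def)
  next
    show "(\<lambda>s. \<phi> (of_int q * s, y - of_int p * s)) integrable_on cbox 0 (2 * pi)" for y
      using orbit_integrable[OF assms] by simp
  next
    show "continuous_on (UNIV \<times> cbox 0 (2 * pi))
        (\<lambda>(y, s). partial_x \<phi> (of_int q * s, y - of_int p * s))"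
      unfolding split_beta
      by (intro continuous_on_compose2[OF
            test_functions_continuous[OF partial_test_functions(2)[OF assms], of UNIV]]
          continuous_intros) simp
  qed simp_all
  then show ?thesis
    by (simp only: orbit_integral_def[abs_def] cbox_interval)
qed

text \<open>Each step differentiates the zero function of \<open>x\<close>. This is why the averages
  have to vanish on all orbits, and not only on the one at which they are finally evaluated.\<close>

lemma orbit_integral_partial_x_funpow_eq_0:
  assumes "\<phi> \<in> test_functions" "\<And>x. orbit_integral p q \<phi> x = 0"
  shows "orbit_integral p q ((partial_x ^^ N) \<phi>) x = 0"
proof (induction N arbitrary: x)
  case 0
  then show ?case
    using assms by simp
next
  case (Suc N)
  then have "orbit_integral p q ((partial_x ^^ N) \<phi>) = (\<lambda>x. 0)"
    by auto
  with orbit_integral_has_vector_derivative[OF partial_x_funpow_test_functions[OF assms(1)]]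
  have "((\<lambda>x. 0) has_vector_derivative orbit_integral p q (partial_x ((partial_x ^^ N) \<phi>)) x) (at x)"
    by metis
  then show ?case
    by (simp add: vector_derivative_unique_at[OF _ has_vector_derivative_const])
qed

text \<open>The difference is written as a sum with the coefficient \<open>- of_int p\<close>, so
  that the sum and multiple rules for \<open>orbit_integral\<close> apply to it directly.\<close>

lemma orbit_has_vector_derivative:
  assumes "\<phi> \<in> test_functions"
  shows "((\<lambda>s. \<phi> (of_int q * s, x - of_int p * s)) has_vector_derivative
    of_int q * partial_t \<phi> (of_int q * s, x - of_int p * s) +
    (- of_int p) * partial_x \<phi> (of_int q * s, x - of_int p * s)) (at s)"
proof -
  have "((\<lambda>s. (of_int q * s, x - of_int p * s)) has_derivative
      (\<lambda>h. (of_int q * h, 0 - of_int p * h))) (at s)"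
    by (intro has_derivative_Pair has_derivative_diff has_derivative_const
        has_derivative_mult_right has_derivative_ident)
  from has_derivative_compose[OF this test_functions_has_derivative[OF assms]]
  show ?thesis
    by (simp add: has_vector_derivative_def scaleR_conv_of_real algebra_simps)
qed

text \<open>Fundamental theorem of calculus along the curve: the integral of the derivative is the
  difference of the values at the endpoints, which are the same point of the torus.\<close>

lemma orbit_integral_directional_derivative:
  assumes "\<phi> \<in> test_functions"
  shows "of_int q * orbit_integral p q (partial_t \<phi>) x = of_int p * orbit_integral p q (partial_x \<phi>) x"
proof -
  let ?\<gamma> = "\<lambda>s. (of_int q * s, x - of_int p * s) :: real \<times> real"
  have int: "((\<lambda>s. of_int q * partial_t \<phi> (?\<gamma> s) + (- of_int p) * partial_x \<phi> (?\<gamma> s)) has_integral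
      \<phi> (?\<gamma> (2 * pi)) - \<phi> (?\<gamma> 0)) {0..2 * pi}"
    by (rule fundamental_theorem_of_calculus[OF _
          has_vector_derivative_at_within[OF orbit_has_vector_derivative[OF assms]]]) simp
  \<comment> \<open>The endpoint differs from the starting point by \<open>q\<close> periods in
    \<open>t\<close> and \<open>- p\<close> periods in \<open>x\<close>; integrality of both closes
    the orbit.\<close>
  have "\<phi> (?\<gamma> (2 * pi)) = \<phi> (?\<gamma> 0)"
    using test_functions_periodic[OF assms, of 0 q x "- p"] by simp
  then have "orbit_integral p q
      (\<lambda>z. of_int q * partial_t \<phi> z + (- of_int p) * partial_x \<phi> z) x = 0"
    unfolding orbit_integral_def by (simp only: integral_unique[OF int] diff_self)
  then have "of_int q * orbit_integral p q (partial_t \<phi>) x +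
      (- of_int p) * orbit_integral p q (partial_x \<phi>) x = 0"
    by (simp only: orbit_integral_add orbit_integral_cmult test_functions_cmult
        partial_test_functions assms)
  then show ?thesis
    by simp
qed

section \<open>Derivatives of orbit measures as solutions\<close>

text \<open>Up to the sign \<open>(-1)^N\<close>, the \<open>N\<close>-th distributional
  \<open>x\<close>-derivative of the image of Lebesgue measure on \<open>{0..2 * pi}\<close> under
  \<open>s \<mapsto> (q s, - p s)\<close>. The default 0 is the normalisation demanded by
  \<open>distributions\<close>.\<close>

definition orbit_distribution :: "int \<Rightarrow> int \<Rightarrow> nat \<Rightarrow> functional" where
  "orbit_distribution p q N \<phi> =
     (if \<phi> \<in> test_functions then orbit_integral p q ((partial_x ^^ N) \<phi>) 0 else 0)"

lemma orbit_distribution_add: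
  assumes "\<phi> \<in> test_functions" "\<psi> \<in> test_functions"
  shows "orbit_distribution p q N (\<lambda>z. \<phi> z + \<psi> z) =
    orbit_distribution p q N \<phi> + orbit_distribution p q N \<psi>"
  using assms by (simp add: orbit_distribution_def test_functions_add partial_x_funpow_add
      orbit_integral_add partial_x_funpow_test_functions)

lemma orbit_distribution_cmult:
  assumes "\<phi> \<in> test_functions"
  shows "orbit_distribution p q N (\<lambda>z. c * \<phi> z) = c * orbit_distribution p q N \<phi>"
  using assms by (simp add: orbit_distribution_def test_functions_cmult partial_x_funpow_cmult
      orbit_integral_cmult)

text \<open>Only the derivative with \<open>i = 0\<close> and \<open>j = N\<close> is involved; its
  uniform convergence passes to the integral over a bounded interval.\<close>

lemma orbit_distribution_tendsto:
  assumes "\<And>n. \<phi> n \<in> test_functions" "\<psi> \<in> test_functions" "test_converges \<phi> \<psi>"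
  shows "(\<lambda>n. orbit_distribution p q N (\<phi> n)) \<longlonglongrightarrow> orbit_distribution p q N \<psi>"
proof -
  let ?g = "\<lambda>f s. (partial_x ^^ N) f (of_int q * s, 0 - of_int p * s)"
  have "uniform_limit UNIV (\<lambda>n. (partial_t ^^ 0) ((partial_x ^^ N) (\<phi> n)))
     ((partial_t ^^ 0) ((partial_x ^^ N) \<psi>)) sequentially"
    using assms(3) unfolding test_converges_def by blast
  then have lim: "uniform_limit {0..2 * pi} (\<lambda>n. ?g (\<phi> n)) (?g \<psi>) sequentially"
    unfolding uniform_limit_iff funpow_0 by (fast elim: eventually_mono)
  have cont: "continuous_on {0..2 * pi} (?g (\<phi> n))" for n
    by (intro orbit_continuous partial_x_funpow_test_functions assms)
  obtain I J where I: "\<And>n. (?g (\<phi> n) has_integral I n) {0..2 * pi}"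
    and J: "(?g \<psi> has_integral J) {0..2 * pi}" and "I \<longlonglongrightarrow> J"
    by (rule uniform_limit_integral[OF lim cont sequentially_bot]) (rule that)
  moreover have "I = (\<lambda>n. orbit_distribution p q N (\<phi> n))" "J = orbit_distribution p q N \<psi>"
    unfolding orbit_distribution_def orbit_integral_def
    by (simp_all only: assms if_True integral_unique[OF I] integral_unique[OF J])
  ultimately show ?thesis
    by (simp only:)
qed

lemma orbit_distribution_in_distributions: "orbit_distribution p q N \<in> distributions"
  unfolding distributions_def
  by (auto simp: orbit_distribution_add orbit_distribution_cmult
      intro!: orbit_distribution_tendsto) (simp add: orbit_distribution_def)

lemma L_op_orbit_distribution:
  assumes "q \<noteq> 0"
  shows "L_op (of_int p / of_int q) (orbit_distribution p q N) = (\<lambda>\<phi>. 0)"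
proof
  fix \<phi>
  show "L_op (of_int p / of_int q) (orbit_distribution p q N) \<phi> = 0"
  proof (cases "\<phi> \<in> test_functions")
    case True
    \<comment> \<open>With \<open>c = - a\<close>, the value of \<open>L_op a u\<close> at
      \<open>\<phi>\<close> is \<open>- u \<psi>\<close> for the test function \<open>\<psi>\<close>
      below, which is \<open>L\<close> applied to \<open>\<phi>\<close>.\<close>
    define c :: complex where "c = - (of_int p / of_int q)"
    define \<psi> where "\<psi> z = partial_t \<phi> z + c * partial_x \<phi> z" for z
    have tf: "partial_t \<phi> \<in> test_functions" "(\<lambda>z. c * partial_x \<phi> z) \<in> test_functions"
      using True by (simp_all add: partial_test_functions test_functions_cmult)
    then have \<psi>: "\<psi> \<in> test_functions"
      unfolding \<psi>_def[abs_def] by (rule test_functions_add)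
    have "orbit_integral p q \<psi> x = 0" for x
    proof -
      have "orbit_integral p q \<psi> x =
          orbit_integral p q (partial_t \<phi>) x + c * orbit_integral p q (partial_x \<phi>) x"
        unfolding \<psi>_def[abs_def] orbit_integral_add[OF tf] orbit_integral_cmult ..
      then show ?thesis
        using orbit_integral_directional_derivative[OF True, of q p x] assms
        by (simp add: c_def field_simps)
    qed
    then have "orbit_distribution p q N \<psi> = 0"
      by (simp add: orbit_distribution_def orbit_integral_partial_x_funpow_eq_0 \<psi>)
    then have "orbit_distribution p q N (partial_t \<phi>) + c * orbit_distribution p q N (partial_x \<phi>) = 0"
      unfolding \<psi>_def[abs_def] using True
      by (simp add: orbit_distribution_add tf orbit_distribution_cmult partial_test_functions)
    then show ?thesis
      using True by (simp add: L_op_def dist_t_def dist_x_def c_def)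
  qed (simp add: L_op_def dist_t_def dist_x_def)
qed

section \<open>Characters and Fourier coefficients\<close>

text \<open>The test function inside \<open>fourier_coeff\<close>, hence with a negative sign in the
  exponent.\<close>

definition character :: "int \<Rightarrow> int \<Rightarrow> real \<times> real \<Rightarrow> complex" where
  "character \<tau> \<xi> = (\<lambda>(t, x). exp (- \<i> * of_real (t * of_int \<tau> + x * of_int \<xi>)))"

lemma character_has_derivative:
  "(character \<tau> \<xi> has_derivative
     (\<lambda>(h, k). - \<i> * of_real (h * of_int \<tau> + k * of_int \<xi>) * character \<tau> \<xi> z)) (at z)"
proof -
  have "((\<lambda>z. - \<i> * of_real (fst z * of_int \<tau> + snd z * of_int \<xi>)) has_derivative
      (\<lambda>v. - \<i> * of_real (fst v * of_int \<tau> + snd v * of_int \<xi>))) (at z)"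
    by (intro has_derivative_mult_right has_derivative_of_real has_derivative_add
        has_derivative_mult_left has_derivative_fst has_derivative_snd has_derivative_ident)
  then have "((\<lambda>z. exp (- \<i> * of_real (fst z * of_int \<tau> + snd z * of_int \<xi>))) has_derivative
      (\<lambda>v. - \<i> * of_real (fst v * of_int \<tau> + snd v * of_int \<xi>) *
        exp (- \<i> * of_real (fst z * of_int \<tau> + snd z * of_int \<xi>)))) (at z)"
    by (rule has_derivative_compose[THEN has_derivative_eq_rhs])
      (auto intro!: DERIV_exp[unfolded has_field_derivative_def] simp: algebra_simps)
  then show ?thesis
    by (simp add: character_def split_beta')
qed

lemma partial_character:
  "partial_t (character \<tau> \<xi>) = (\<lambda>z. (- \<i> * of_int \<tau>) * character \<tau> \<xi> z)"
  "partial_x (character \<tau> \<xi>) = (\<lambda>z. (- \<i> * of_int \<xi>) * character \<tau> \<xi> z)"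
  by (rule ext, simp add: partial_unique[OF character_has_derivative])+

text \<open>Both partial derivatives are constant multiples of the character itself, so the
  induction closes through \<open>C_k_cmult\<close>.\<close>

lemma C_k_character: "C_k k (character \<tau> \<xi>)"
proof (induction k)
  case 0
  then show ?case
    using has_derivative_continuous[OF character_has_derivative]
    by (simp add: continuous_on_eq_continuous_at)
next
  case (Suc k)
  moreover have "character \<tau> \<xi> differentiable_on UNIV"
    using character_has_derivative unfolding differentiable_on_def differentiable_def by blast
  ultimately show ?case
    by (simp only: C_k.simps partial_character C_k_cmult)
qed

lemma character_test_functions: "character \<tau> \<xi> \<in> test_functions"
  by (auto simp: test_functions_def C_k_character)
    (simp_all add: character_def algebra_simps exp_add exp_diff exp_minus)

lemma partial_x_funpow_character:
  "(partial_x ^^ N) (character \<tau> \<xi>) = (\<lambda>z. (- \<i> * of_int \<xi>) ^ N * character \<tau> \<xi> z)"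
  by (induction N)
    (auto simp: partial_cmult partial_character test_functions_differentiable
      character_test_functions)

text \<open>On the orbit through the origin the phase is \<open>q s p n - p s q n = 0\<close>, so
  this character is constantly 1 there and integrates to \<open>2 pi\<close>. Each
  \<open>x\<close>-derivative contributes a factor \<open>- \<i> q n\<close>.\<close>

lemma fourier_coeff_orbit_distribution:
  "fourier_coeff (orbit_distribution p q N) (p * n) (q * n) =
     (- \<i> * of_int (q * n)) ^ N / (2 * of_real pi)"
proof -
  have "orbit_integral p q (character (p * n) (q * n)) 0 = 2 * of_real pi"
    by (simp add: orbit_integral_def character_def algebra_simps) (simp add: scaleR_conv_of_real)
  then show ?thesis
    unfolding fourier_coeff_def character_def[symmetric]
    by (simp add: orbit_distribution_def character_test_functions partial_x_funpow_character
        orbit_integral_cmult power2_eq_square)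
qed

section \<open>Lower bounds for the terms of the mixed Sobolev sum\<close>

lemma japanese_bracket_bounds:
  "1 \<le> japanese_bracket w" "japanese_bracket w \<le> 1 + \<bar>w\<bar>"
proof -
  show "1 \<le> japanese_bracket w"
    unfolding japanese_bracket_def by (rule ge_one_powr_ge_zero) auto
  show "japanese_bracket w \<le> 1 + \<bar>w\<bar>"
    using sqrt_sum_squares_le_sum_abs[of 1 w]
    by (simp add: japanese_bracket_def powr_half_sqrt)
qed

text \<open>Since the bracket lies between 1 and \<open>B\<close>, the negative exponent
  \<open>- (2 * \<bar>k\<bar>)\<close> is the worst case for either sign of
  \<open>k\<close>.\<close>

lemma japanese_bracket_powr_ge:
  assumes "1 + \<bar>w\<bar> \<le> B"
  shows "B powr (- (2 * \<bar>k\<bar>)) \<le> japanese_bracket w powr (2 * k)"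
proof -
  have "B powr (- (2 * \<bar>k\<bar>)) \<le> japanese_bracket w powr (- (2 * \<bar>k\<bar>))"
    using japanese_bracket_bounds[of w] assms by (intro powr_mono2') linarith+
  also have "\<dots> \<le> japanese_bracket w powr (2 * k)"
    using japanese_bracket_bounds[of w] by (intro powr_mono) linarith+
  finally show ?thesis .
qed

lemma japanese_bracket_product_ge:
  assumes "1 + \<bar>v\<bar> \<le> B" "1 + \<bar>w\<bar> \<le> B" "\<bar>k1\<bar> + \<bar>k2\<bar> \<le> M"
  shows "B powr (- (2 * M)) \<le> japanese_bracket v powr (2 * k1) * japanese_bracket w powr (2 * k2)"
proof -
  have "B powr (- (2 * M)) \<le> B powr (- (2 * \<bar>k1\<bar>) + - (2 * \<bar>k2\<bar>))"
    using order_trans[OF _ assms(1), of 1] assms(3) by (intro powr_mono) simp_all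
  also have "\<dots> \<le> japanese_bracket v powr (2 * k1) * japanese_bracket w powr (2 * k2)"
    unfolding powr_add
    by (rule mult_mono[OF japanese_bracket_powr_ge[OF assms(1)] japanese_bracket_powr_ge[OF assms(2)]])
      simp_all
  finally show ?thesis .
qed

text \<open>Injectivity turns the subfamily of a summable family into a convergent series, whose
  terms tend to 0.\<close>

lemma H_mix_term_tendsto_0:
  fixes f g :: "nat \<Rightarrow> int"
  assumes "u \<in> H_mix k1 k2" "inj (\<lambda>n. (f n, g n))"
  shows "(\<lambda>n. japanese_bracket (of_int (f n)) powr (2 * k1) *
    japanese_bracket (of_int (g n)) powr (2 * k2) *
    (cmod (fourier_coeff u (f n) (g n)))\<^sup>2) \<longlonglongrightarrow> 0"
proof -
  let ?F = "\<lambda>(\<tau>, \<xi>). japanese_bracket (of_int \<tau>) powr (2 * k1) *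
    japanese_bracket (of_int \<xi>) powr (2 * k2) * (cmod (fourier_coeff u \<tau> \<xi>))\<^sup>2"
  have "?F summable_on range (\<lambda>n. (f n, g n))"
    using assms(1) unfolding H_mix_def by (blast intro: summable_on_subset_banach)
  then have "summable (?F \<circ> (\<lambda>n. (f n, g n)))"
    using assms(2) by (intro summable_on_imp_summable) (simp only: summable_on_reindex)
  then show ?thesis
    by (auto dest: summable_LIMSEQ_zero simp: o_def)
qed

lemma cmod_fourier_coeff_orbit_distribution:
  assumes "q \<ge> 0"
  shows "cmod (fourier_coeff (orbit_distribution p q N) (p * int n) (q * int n)) =
    (of_int q * real n) ^ N / (2 * pi)"
  using assms
  by (simp add: fourier_coeff_orbit_distribution norm_divide norm_power norm_mult abs_mult)

text \<open>One bound for both frequencies, linear in \<open>m\<close>, serves as the common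
  \<open>B\<close> of \<open>japanese_bracket_product_ge\<close>.\<close>

lemma orbit_frequency_le:
  fixes m :: real
  assumes "m \<ge> 1"
  shows "1 + \<bar>of_int p * m\<bar> \<le> (1 + \<bar>of_int p\<bar> + \<bar>of_int q\<bar>) * m"
    "1 + \<bar>of_int q * m\<bar> \<le> (1 + \<bar>of_int p\<bar> + \<bar>of_int q\<bar>) * m"
proof -
  have m: "0 \<le> m"
    using assms by simp
  have "1 + x \<le> m + x + y" "1 + y \<le> m + x + y" if "0 \<le> x" "0 \<le> y" for x y
    using assms that by linarith+
  note this[OF mult_nonneg_nonneg[OF abs_ge_zero m] mult_nonneg_nonneg[OF abs_ge_zero m]]
  then show "1 + \<bar>of_int p * m\<bar> \<le> (1 + \<bar>of_int p\<bar> + \<bar>of_int q\<bar>) * m"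
    "1 + \<bar>of_int q * m\<bar> \<le> (1 + \<bar>of_int p\<bar> + \<bar>of_int q\<bar>) * m"
    by (simp_all only: abs_mult abs_of_nonneg[OF m] distrib_right mult_1)
qed

text \<open>The growth \<open>(m ^ N)\<^sup>2\<close> of the squared coefficients exactly cancels
  the worst decay of the weights and leaves a constant independent of \<open>m\<close>.\<close>

lemma powr_minus_double_eq:
  fixes K m :: real
  assumes "K > 0" "m > 0"
  shows "K powr (- (2 * real N)) = (K * m) powr (- (2 * real N)) * (m ^ N)\<^sup>2"
  using assms powr_realpow[of m "N * 2"]
  by (simp add: powr_mult powr_minus power_mult mult.commute)

lemma orbit_distribution_H_mix_term_ge:
  assumes "q > 0" "\<bar>k1\<bar> + \<bar>k2\<bar> \<le> real N" "n > 0"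
  shows "(1 + \<bar>of_int p\<bar> + \<bar>of_int q\<bar>) powr (- (2 * real N)) / (2 * pi)\<^sup>2 \<le>
    japanese_bracket (of_int (p * int n)) powr (2 * k1) *
    japanese_bracket (of_int (q * int n)) powr (2 * k2) *
    (cmod (fourier_coeff (orbit_distribution p q N) (p * int n) (q * int n)))\<^sup>2"
proof -
  define K :: real where "K = 1 + \<bar>of_int p\<bar> + \<bar>of_int q\<bar>"
  have n: "real n \<ge> 1"
    using assms(3) by simp
  have "K powr (- (2 * real N)) = (K * real n) powr (- (2 * real N)) * (real n ^ N)\<^sup>2"
    using n by (intro powr_minus_double_eq) (simp_all add: K_def)
  \<comment> \<open>As \<open>q\<close> is a positive integer,
    \<open>real n \<le> of_int q * real n\<close>, which bounds the last factor.\<close>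
  also have "\<dots> \<le> japanese_bracket (of_int p * real n) powr (2 * k1) *
      japanese_bracket (of_int q * real n) powr (2 * k2) * ((of_int q * real n) ^ N)\<^sup>2"
    using assms(1) n unfolding K_def
    by (intro mult_mono japanese_bracket_product_ge orbit_frequency_le n assms(2) power_mono) simp_all
  finally have "K powr (- (2 * real N)) / (2 * pi)\<^sup>2 \<le> \<dots> / (2 * pi)\<^sup>2"
    by (rule divide_right_mono) simp
  then show ?thesis
    using assms(1) by (simp add: cmod_fourier_coeff_orbit_distribution power_divide K_def)
qed

lemma orbit_distribution_notin_H_mix:
  assumes "q > 0" "\<bar>k1\<bar> + \<bar>k2\<bar> \<le> real N"
  shows "orbit_distribution p q N \<notin> H_mix k1 k2"
proof
  assume "orbit_distribution p q N \<in> H_mix k1 k2"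
  moreover have "inj (\<lambda>n. (p * int (Suc n), q * int (Suc n)))"
    using assms(1) by (simp add: inj_def)
  ultimately have "(\<lambda>n. japanese_bracket (of_int (p * int (Suc n))) powr (2 * k1) *
      japanese_bracket (of_int (q * int (Suc n))) powr (2 * k2) *
      (cmod (fourier_coeff (orbit_distribution p q N) (p * int (Suc n)) (q * int (Suc n))))\<^sup>2) \<longlonglongrightarrow> 0"
    by (rule H_mix_term_tendsto_0)
  \<comment> \<open>A constant lower bound of all terms passes to their limit 0, although this
    constant is positive.\<close>
  then have "(1 + \<bar>of_int p\<bar> + \<bar>of_int q\<bar>) powr (- (2 * real N)) / (2 * pi)\<^sup>2 \<le> 0"
    by (rule LIMSEQ_le_const)
      (intro exI allI impI orbit_distribution_H_mix_term_ge[OF assms zero_less_Suc])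
  moreover have "(1 + \<bar>of_int p\<bar> + \<bar>of_int q\<bar>) powr (- (2 * real N)) / (2 * pi)\<^sup>2 > 0"
    using assms(1) by (intro divide_pos_pos) simp_all
  ultimately show False
    by linarith
qed

text \<open>Makes every functional outside \<open>H_mix k1 k2\<close> automatically nonzero.\<close>

lemma zero_in_H_mix: "(\<lambda>\<phi>. 0) \<in> H_mix k1 k2"
  by (simp add: H_mix_def distributions_def fourier_coeff_def split_beta')

theorem proposition4p7:
  fixes a :: real and k1 k2 :: real
  assumes "a \<in> \<rat>"
  shows "\<exists>u \<in> distributions. u \<noteq> (\<lambda>\<phi>. 0) \<and> L_op a u = (\<lambda>\<phi>. 0) \<and> u \<notin> H_mix k1 k2"
proof -
  obtain p q :: int where a: "q > 0" "a = of_int p / of_int q"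
    using assms by (rule Rats_cases') auto
  \<comment> \<open>The order is the least natural number that is at least
    \<open>\<bar>k1\<bar> + \<bar>k2\<bar>\<close>, as the lower bound on the Sobolev terms
    requires.\<close>
  let ?u = "orbit_distribution p q (nat \<lceil>\<bar>k1\<bar> + \<bar>k2\<bar>\<rceil>)"
  have "?u \<notin> H_mix k1 k2"
    using a(1) real_nat_ceiling_ge by (rule orbit_distribution_notin_H_mix)
  moreover from this have "?u \<noteq> (\<lambda>\<phi>. 0)"
    using zero_in_H_mix by metis
  moreover have "L_op a ?u = (\<lambda>\<phi>. 0)"
    unfolding a(2) using a(1) by (intro L_op_orbit_distribution) simp
  ultimately show ?thesis
    using orbit_distribution_in_distributions by blast
qed

end
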